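(* Let $m,\omega,\hbar$ be positive real numbers and let $\xi=\xi_1\mathbf{e_1}+\xi_2\mathbf{e_2}$ with $\xi_1,\xi_2$ real and $>0$. On the $\mathbb{T}$-module $M_S$ of bicomplex functions of a real variable defined in the context, let $X\{u(x)\}=x\,u(x)$, $P\{u(x)\}=-\mathrm{i}_1\hbar\xi\,\frac{\mathrm{d}u(x)}{\mathrm{d}x}$ and $$H=\frac{1}{2m}P^2+\frac12m\omega^2X^2 .$$ For each integer $l\ge0$ let $$\phi_l(x)=\left[\sqrt{\frac{m\omega}{\pi\hbar\xi}}\;\frac{1}{2^l\,l!}\right]^{1/2}\mathrm{e}^{-\theta^2/2}\,H_l(\theta),\qquad \theta=\sqrt{\frac{m\omega}{\hbar\xi}}\;x ,$$ where $H_l(\theta)=\mathbf{e_1}H_l(\theta_1)+\mathbf{e_2}H_l(\theta_2)$ is the hyperbolic Hermite polynomial of order $l$, with $\theta=\theta_1\mathbf{e_1}+\theta_2\mathbf{e_2}$, $\theta_k=\sqrt{m\omega/(\hbar\xi_k)}\,x$. Then $\phi_l\in M_S$, $\phi_l$ is an eigenfunction of $H$ with $$H\phi_l=\left(l+\tfrac12\right)\hbar\omega\,\xi\,\phi_l ,$$ and $\phi_l$ is normalized: $(\phi_l,\phi_l)=1$.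
   Context: Bicomplex numbers: $\mathbb{T}=\{w_e+w_{1}\mathrm{i}_1+w_{2}\mathrm{i}_2+w_j\mathrm{j} : w_e,w_1,w_2,w_j\in\mathbb{R}\}$ is the commutative ring with $\mathrm{i}_1^2=\mathrm{i}_2^2=-1$, $\mathrm{j}^2=1$, $\mathrm{i}_1\mathrm{i}_2=\mathrm{j}$, $\mathrm{i}_1\mathrm{j}=-\mathrm{i}_2$, $\mathrm{i}_2\mathrm{j}=-\mathrm{i}_1$. Put $\mathbf{e_1}=(1+\mathrm{j})/2$, $\mathbf{e_2}=(1-\mathrm{j})/2$; these are idempotent, $\mathbf{e_1}+\mathbf{e_2}=1$, $\mathbf{e_1}\mathbf{e_2}=0$. Every $w\in\mathbb{T}$ is uniquely $w=z_1\mathbf{e_1}+z_2\mathbf{e_2}$ with $z_1,z_2\in\mathbb{C}(\mathrm{i}_1)=\{x+y\mathrm{i}_1:x,y\in\mathbb{R}\}$, and operations are componentwise. The conjugate is $w^\dagger=\bar z_1\mathbf{e_1}+\bar z_2\mathbf{e_2}$. The exponential, polynomials with real coefficients, and (for hyperbolic numbers $x_1\mathbf{e_1}+x_2\mathbf{e_2}$ with $x_1,x_2>0$) inverses and positive real roots act componentwise, e.g. $\mathrm{e}^{w}=\mathbf{e_1}\mathrm{e}^{z_1}+\mathbf{e_2}\mathrm{e}^{z_2}$ and $\xi^{-1/4}=\mathbf{e_1}\xi_1^{-1/4}+\mathbf{e_2}\xi_2^{-1/4}$. Let $S$ be the set of all finite linear combinations, with coefficients in $\mathbb{C}(\mathrm{i}_1)$,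 of the functions $f_{n,\alpha}(x)=x^n\exp(-\alpha x^2)$ of the real variable $x$, where $n$ ranges over non-negative integers and $\alpha$ over positive reals. $M_S$ is the $\mathbb{T}$-module of all functions $u(x)=\mathbf{e_1}u_1(x)+\mathbf{e_2}u_2(x)$ with $u_1,u_2\in S$, with scalar product $$(u,v)=\int_{-\infty}^{\infty}u^\dagger(x)v(x)\,\mathrm{d}x=\int_{-\infty}^\infty[\mathbf{e_1}\bar u_1(x)v_1(x)+\mathbf{e_2}\bar u_2(x)v_2(x)]\,\mathrm{d}x .$$ For a real argument, $H_l$ denotes the usual (physicists') Hermite polynomial of order $l$, $H_l(t)=(-1)^l\mathrm{e}^{t^2}\frac{\mathrm{d}^l}{\mathrm{d}t^l}\mathrm{e}^{-t^2}$. (The symbol $H$ without index is the Hamiltonian operator.) *)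

theory Defs
  imports "HOL-Analysis.Analysis"
begin

section \<open>Bicomplex numbers\<close>

codatatype bicomplex = Bicomplex (bc_e: real) (bc_1: real) (bc_2: real) (bc_j: real)

lemma bicomplex_eq_iff:
  "w = v \<longleftrightarrow> bc_e w = bc_e v \<and> bc_1 w = bc_1 v \<and> bc_2 w = bc_2 v \<and> bc_j w = bc_j v"
  by (auto intro: bicomplex.expand)

lemma bicomplex_eqI [intro?]:
  "\<lbrakk>bc_e w = bc_e v; bc_1 w = bc_1 v; bc_2 w = bc_2 v; bc_j w = bc_j v\<rbrakk> \<Longrightarrow> w = v"
  by (simp add: bicomplex_eq_iff)

text \<open>The product is the one forced by \<open>i\<^sub>1\<^sup>2 = i\<^sub>2\<^sup>2 = -1\<close>, \<open>j\<^sup>2 = 1\<close>, \<open>i\<^sub>1 i\<^sub>2 = j\<close>,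
  \<open>i\<^sub>1 j = - i\<^sub>2\<close>, \<open>i\<^sub>2 j = - i\<^sub>1\<close>; see \<open>bicomplex_units\<close> below.\<close>

instantiation bicomplex :: comm_ring_1
begin

primcorec zero_bicomplex where
  "bc_e 0 = 0" | "bc_1 0 = 0" | "bc_2 0 = 0" | "bc_j 0 = 0"

primcorec one_bicomplex where
  "bc_e 1 = 1" | "bc_1 1 = 0" | "bc_2 1 = 0" | "bc_j 1 = 0"

primcorec plus_bicomplex where
  "bc_e (w + v) = bc_e w + bc_e v"
| "bc_1 (w + v) = bc_1 w + bc_1 v"
| "bc_2 (w + v) = bc_2 w + bc_2 v"
| "bc_j (w + v) = bc_j w + bc_j v"

primcorec uminus_bicomplex where
  "bc_e (- w) = - bc_e w"
| "bc_1 (- w) = - bc_1 w"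
| "bc_2 (- w) = - bc_2 w"
| "bc_j (- w) = - bc_j w"

primcorec minus_bicomplex where
  "bc_e (w - v) = bc_e w - bc_e v"
| "bc_1 (w - v) = bc_1 w - bc_1 v"
| "bc_2 (w - v) = bc_2 w - bc_2 v"
| "bc_j (w - v) = bc_j w - bc_j v"

primcorec times_bicomplex where
  "bc_e (w * v) = bc_e w * bc_e v - bc_1 w * bc_1 v - bc_2 w * bc_2 v + bc_j w * bc_j v"
| "bc_1 (w * v) = bc_e w * bc_1 v + bc_1 w * bc_e v - bc_2 w * bc_j v - bc_j w * bc_2 v"
| "bc_2 (w * v) = bc_e w * bc_2 v + bc_2 w * bc_e v - bc_1 w * bc_j v - bc_j w * bc_1 v"
| "bc_j (w * v) = bc_e w * bc_j v + bc_j w * bc_e v + bc_1 w * bc_2 v + bc_2 w * bc_1 v"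

instance
  by standard (auto simp: bicomplex_eq_iff algebra_simps)

end

text \<open>The topology is that of \<open>\<real>\<^sup>4\<close>.  The Euclidean norm is not submultiplicative, so
  \<open>bicomplex\<close> is not an instance of \<open>real_normed_algebra\<close>.\<close>

instantiation bicomplex :: real_algebra_1
begin

primcorec scaleR_bicomplex where
  "bc_e (scaleR r w) = r * bc_e w"
| "bc_1 (scaleR r w) = r * bc_1 w"
| "bc_2 (scaleR r w) = r * bc_2 w"
| "bc_j (scaleR r w) = r * bc_j w"

instance
  by standard (auto simp: bicomplex_eq_iff algebra_simps)

end

instantiation bicomplex :: real_inner
begin

definition inner_bicomplex :: "bicomplex \<Rightarrow> bicomplex \<Rightarrow> real" where
  "inner_bicomplex w v = bc_e w * bc_e v + bc_1 w * bc_1 v + bc_2 w * bc_2 v + bc_j w * bc_j v"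

definition norm_bicomplex :: "bicomplex \<Rightarrow> real" where
  "norm_bicomplex w = sqrt (inner w w)"

definition sgn_bicomplex :: "bicomplex \<Rightarrow> bicomplex" where
  "sgn_bicomplex w = scaleR (inverse (norm w)) w"

definition dist_bicomplex :: "bicomplex \<Rightarrow> bicomplex \<Rightarrow> real" where
  "dist_bicomplex w v = norm (w - v)"

definition uniformity_bicomplex :: "(bicomplex \<times> bicomplex) filter" where
  "uniformity_bicomplex = (INF e\<in>{0<..}. principal {(w, v). dist w v < e})"

definition open_bicomplex :: "bicomplex set \<Rightarrow> bool" where
  "open_bicomplex U \<longleftrightarrow> (\<forall>w\<in>U. eventually (\<lambda>(w', v). w' = w \<longrightarrow> v \<in> U) uniformity)"

instance
proof
  fix w v u :: bicomplex and r :: real and U :: "bicomplex set"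
  show "dist w v = norm (w - v)" by (rule dist_bicomplex_def)
  show "sgn w = scaleR (inverse (norm w)) w" by (rule sgn_bicomplex_def)
  show "(uniformity :: (bicomplex \<times> bicomplex) filter) =
      (INF e\<in>{0<..}. principal {(w, v). dist w v < e})" by (rule uniformity_bicomplex_def)
  show "open U \<longleftrightarrow> (\<forall>w\<in>U. eventually (\<lambda>(w', v). w' = w \<longrightarrow> v \<in> U) uniformity)"
    by (rule open_bicomplex_def)
  show "inner w v = inner v w" by (simp add: inner_bicomplex_def mult.commute)
  show "inner (w + v) u = inner w u + inner v u"
    by (simp add: inner_bicomplex_def algebra_simps)
  show "inner (scaleR r w) v = r * inner w v"
    by (simp add: inner_bicomplex_def algebra_simps)
  show "0 \<le> inner w w" by (simp add: inner_bicomplex_def)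
  show "inner w w = 0 \<longleftrightarrow> w = 0"
    by (auto simp: inner_bicomplex_def bicomplex_eq_iff add_nonneg_eq_0_iff)
  show "norm w = sqrt (inner w w)" by (rule norm_bicomplex_def)
qed

end

definition unit_i1 :: bicomplex where "unit_i1 = Bicomplex 0 1 0 0"
definition unit_i2 :: bicomplex where "unit_i2 = Bicomplex 0 0 1 0"
definition unit_j :: bicomplex where "unit_j = Bicomplex 0 0 0 1"

instantiation bicomplex :: euclidean_space
begin

definition Basis_bicomplex :: "bicomplex set" where
  "Basis_bicomplex = {1, unit_i1, unit_i2, unit_j}"

instance
proof
  fix u v :: bicomplex
  show "(Basis :: bicomplex set) \<noteq> {}" by (simp add: Basis_bicomplex_def)
  show "finite (Basis :: bicomplex set)" by (simp add: Basis_bicomplex_def)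
  show "u \<in> Basis \<Longrightarrow> v \<in> Basis \<Longrightarrow> inner u v = (if u = v then 1 else 0)"
    by (auto simp: Basis_bicomplex_def inner_bicomplex_def bicomplex_eq_iff
        unit_i1_def unit_i2_def unit_j_def)
  show "(\<forall>b\<in>Basis. inner u b = 0) \<longleftrightarrow> u = 0"
    by (auto simp: Basis_bicomplex_def inner_bicomplex_def unit_i1_def unit_i2_def unit_j_def
        intro: bicomplex_eqI)
qed

end

lemma bicomplex_units:
  "unit_i1 * unit_i1 = - 1" "unit_i2 * unit_i2 = - 1" "unit_j * unit_j = 1"
  "unit_i1 * unit_i2 = unit_j" "unit_i1 * unit_j = - unit_i2" "unit_i2 * unit_j = - unit_i1"
  by (auto simp: bicomplex_eq_iff unit_i1_def unit_i2_def unit_j_def)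

lemma of_real_bicomplex_sel [simp]:
  "bc_e (of_real r) = r" "bc_1 (of_real r) = 0" "bc_2 (of_real r) = 0" "bc_j (of_real r) = 0"
  by (simp_all add: of_real_def)

lemma bicomplex_expand:
  "w = of_real (bc_e w) + of_real (bc_1 w) * unit_i1 + of_real (bc_2 w) * unit_i2
     + of_real (bc_j w) * unit_j"
  by (simp add: bicomplex_eq_iff unit_i1_def unit_i2_def unit_j_def)


section \<open>The idempotent basis and componentwise operations\<close>

definition e1 :: bicomplex where "e1 = scaleR (1/2) (1 + unit_j)"
definition e2 :: bicomplex where "e2 = scaleR (1/2) (1 - unit_j)"

lemma idempotents: "e1 * e1 = e1" "e2 * e2 = e2" "e1 * e2 = 0" "e1 + e2 = 1"
  by (auto simp: bicomplex_eq_iff e1_def e2_def unit_j_def)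

text \<open>The type \<open>complex\<close> is identified with the subring \<open>\<complex>(i\<^sub>1)\<close>.\<close>

definition of_Ci1 :: "complex \<Rightarrow> bicomplex" where
  "of_Ci1 z = of_real (Re z) + of_real (Im z) * unit_i1"

definition comp1 :: "bicomplex \<Rightarrow> complex" where
  "comp1 w = Complex (bc_e w + bc_j w) (bc_1 w - bc_2 w)"
definition comp2 :: "bicomplex \<Rightarrow> complex" where
  "comp2 w = Complex (bc_e w - bc_j w) (bc_1 w + bc_2 w)"

lemma idempotent_decomposition:
  "w = of_Ci1 z1 * e1 + of_Ci1 z2 * e2 \<longleftrightarrow> z1 = comp1 w \<and> z2 = comp2 w"
  by (auto simp: bicomplex_eq_iff complex_eq_iff of_Ci1_def comp1_def comp2_def e1_def e2_def
      unit_i1_def unit_j_def field_simps)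

lemma comp_mult: "comp1 (w * v) = comp1 w * comp1 v" "comp2 (w * v) = comp2 w * comp2 v"
  by (simp_all add: complex_eq_iff comp1_def comp2_def algebra_simps)

definition componentwise :: "(complex \<Rightarrow> complex) \<Rightarrow> bicomplex \<Rightarrow> bicomplex" where
  "componentwise f w = e1 * of_Ci1 (f (comp1 w)) + e2 * of_Ci1 (f (comp2 w))"

text \<open>For real functions; only used at hyperbolic arguments \<open>x\<^sub>1 e\<^sub>1 + x\<^sub>2 e\<^sub>2\<close> with
  \<open>x\<^sub>1, x\<^sub>2\<close> real, where \<open>comp1\<close> and \<open>comp2\<close> are the real numbers \<open>x\<^sub>1, x\<^sub>2\<close>.\<close>

definition hyp_componentwise :: "(real \<Rightarrow> real) \<Rightarrow> bicomplex \<Rightarrow> bicomplex" where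
  "hyp_componentwise f w = e1 * of_real (f (Re (comp1 w))) + e2 * of_real (f (Re (comp2 w)))"

lemma hyp_componentwise_hyperbolic:
  "hyp_componentwise f (of_real x1 * e1 + of_real x2 * e2) = e1 * of_real (f x1) + e2 * of_real (f x2)"
  by (simp add: hyp_componentwise_def comp1_def comp2_def e1_def e2_def unit_j_def)

definition bc_cnj :: "bicomplex \<Rightarrow> bicomplex" where
  "bc_cnj = componentwise cnj"

definition bc_exp :: "bicomplex \<Rightarrow> bicomplex" where
  "bc_exp = componentwise exp"

definition hyp_sqrt :: "bicomplex \<Rightarrow> bicomplex" where
  "hyp_sqrt = hyp_componentwise sqrt"

text \<open>The usual totalisation \<open>inverse 0 = 0\<close> is applied in each component; off the null cone
  this is the multiplicative inverse.\<close>

instantiation bicomplex :: inverse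
begin

definition inverse_bicomplex :: "bicomplex \<Rightarrow> bicomplex" where
  "inverse_bicomplex = componentwise inverse"

definition divide_bicomplex :: "bicomplex \<Rightarrow> bicomplex \<Rightarrow> bicomplex" where
  "divide_bicomplex w v = w * inverse v"

instance ..

end

lemma bicomplex_right_inverse:
  assumes "comp1 w \<noteq> 0" "comp2 w \<noteq> 0"
  shows "w * inverse w = 1"
proof -
  have *: "comp1 (componentwise f w) = f (comp1 w)" "comp2 (componentwise f w) = f (comp2 w)" for f
    using idempotent_decomposition[of "componentwise f w" "f (comp1 w)" "f (comp2 w)"]
    by (simp_all add: componentwise_def mult.commute)
  have "comp1 (w * inverse w) = comp1 1" "comp2 (w * inverse w) = comp2 1"
    using assms by (simp_all add: comp_mult inverse_bicomplex_def *)
      (simp_all add: comp1_def comp2_def complex_eq_iff)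
  then show ?thesis
    by (auto simp: bicomplex_eq_iff comp1_def comp2_def)
qed


section \<open>The module \<open>M\<^sub>S\<close> and its scalar product\<close>

definition S_space :: "(real \<Rightarrow> complex) set" where
  "S_space = {f. \<exists>(A :: (nat \<times> real) set) (c :: nat \<times> real \<Rightarrow> complex).
      finite A \<and> (\<forall>(n, \<alpha>)\<in>A. \<alpha> > 0) \<and>
      f = (\<lambda>x. \<Sum>(n, \<alpha>)\<in>A. c (n, \<alpha>) * of_real (x ^ n * exp (- \<alpha> * x\<^sup>2)))}"

definition M_S :: "(real \<Rightarrow> bicomplex) set" where
  "M_S = {u. \<exists>u1\<in>S_space. \<exists>u2\<in>S_space. u = (\<lambda>x. e1 * of_Ci1 (u1 x) + e2 * of_Ci1 (u2 x))}"

definition scalar_product :: "(real \<Rightarrow> bicomplex) \<Rightarrow> (real \<Rightarrow> bicomplex) \<Rightarrow> bicomplex" where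
  "scalar_product u v = (LINT x|lborel. bc_cnj (u x) * v x)"


section \<open>The bicomplex harmonic oscillator\<close>

definition op_X :: "(real \<Rightarrow> bicomplex) \<Rightarrow> (real \<Rightarrow> bicomplex)" where
  "op_X u = (\<lambda>x. of_real x * u x)"

text \<open>\<open>vector_derivative\<close> is a total function with unspecified values at points of
  non-differentiability; functions in \<open>M_S\<close> are smooth.\<close>

definition op_P :: "real \<Rightarrow> bicomplex \<Rightarrow> (real \<Rightarrow> bicomplex) \<Rightarrow> (real \<Rightarrow> bicomplex)" where
  "op_P hbar \<xi> u = (\<lambda>x. - unit_i1 * of_real hbar * \<xi> * vector_derivative u (at x))"

definition op_H :: "real \<Rightarrow> real \<Rightarrow> real \<Rightarrow> bicomplex \<Rightarrow> (real \<Rightarrow> bicomplex) \<Rightarrow> (real \<Rightarrow> bicomplex)" where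
  "op_H m \<omega> hbar \<xi> u = (\<lambda>x. of_real (1 / (2 * m)) * (op_P hbar \<xi> ^^ 2) u x
      + of_real (1 / 2 * m * \<omega>\<^sup>2) * (op_X ^^ 2) u x)"

definition eigenfunction ::
    "((real \<Rightarrow> bicomplex) \<Rightarrow> (real \<Rightarrow> bicomplex)) \<Rightarrow> bicomplex \<Rightarrow> (real \<Rightarrow> bicomplex) \<Rightarrow> bool" where
  "eigenfunction T c u \<longleftrightarrow> u \<in> M_S \<and> u \<noteq> (\<lambda>x. 0) \<and> T u = (\<lambda>x. c * u x)"

definition hermite :: "nat \<Rightarrow> real \<Rightarrow> real" where
  "hermite l t = (- 1) ^ l * exp (t\<^sup>2) * (deriv ^^ l) (\<lambda>s. exp (- s\<^sup>2)) t"

definition hyp_hermite :: "nat \<Rightarrow> bicomplex \<Rightarrow> bicomplex" where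
  "hyp_hermite l = hyp_componentwise (hermite l)"

definition theta :: "real \<Rightarrow> real \<Rightarrow> real \<Rightarrow> bicomplex \<Rightarrow> real \<Rightarrow> bicomplex" where
  "theta m \<omega> hbar \<xi> x = hyp_sqrt (of_real (m * \<omega>) / (of_real hbar * \<xi>)) * of_real x"

definition phi :: "real \<Rightarrow> real \<Rightarrow> real \<Rightarrow> bicomplex \<Rightarrow> nat \<Rightarrow> real \<Rightarrow> bicomplex" where
  "phi m \<omega> hbar \<xi> l x =
     hyp_sqrt (hyp_sqrt (of_real (m * \<omega>) / (of_real (pi * hbar) * \<xi>)) * of_real (1 / (2 ^ l * fact l)))
     * bc_exp (- of_real (1 / 2) * (theta m \<omega> hbar \<xi> x)\<^sup>2)
     * hyp_hermite l (theta m \<omega> hbar \<xi> x)"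

end

theory Submission
  imports Defs "HOL-Probability.Distributions"
begin

text \<open>In the idempotent basis \<open>\<phi>\<^sub>l\<close> splits into two ordinary oscillator eigenfunctions, with \<open>\<hbar>\<close>
  replaced by \<open>\<hbar> \<xi>\<^sub>1\<close> and \<open>\<hbar> \<xi>\<^sub>2\<close>. The eigenvalue equation is Hermite's differential equation. For the
  norm, integration by parts against \<open>exp (- x\<^sup>2)\<close> makes \<open>H\<^sub>n \<mapsto> 2 x H\<^sub>n - H\<^sub>n'\<close> the adjoint of
  differentiation, and \<open>H\<^sub>n\<^sub>+\<^sub>1' = 2 (n + 1) H\<^sub>n\<close> reduces the norm of \<open>H\<^sub>n\<^sub>+\<^sub>1\<close> to that of \<open>H\<^sub>n\<close>.\<close>

section \<open>Hermite polynomials\<close>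

text \<open>Differentiating \<open>p(s) * exp (- s^2)\<close> replaces p by p' - 2 s p; up to sign
  this is the recursion.\<close>

fun hermite_poly :: "nat \<Rightarrow> real poly" where
  "hermite_poly 0 = 1"
| "hermite_poly (Suc n) = [:0, 2:] * hermite_poly n - pderiv (hermite_poly n)"

text \<open>The derivative of 2 x H - H' is 2 H + 2 x H' - H''. For H of index n + 1 the induction
  hypothesis turns the last two terms into 2 (n + 1) (2 x H_n - H_n'), which is again a multiple of
  H by the recursion.\<close>

lemma pderiv_hermite_poly_Suc:
  "pderiv (hermite_poly (Suc n)) = smult (2 * real (Suc n)) (hermite_poly n)"
proof (induction n)
  case 0
  show ?case by (simp add: pderiv_pCons)
next
  case (Suc n)
  define h where "h = hermite_poly n"
  have IH: "pderiv (hermite_poly (Suc n)) = smult (2 * real (Suc n)) h"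
    using Suc by (simp add: h_def)
  have "pderiv (hermite_poly (Suc (Suc n))) =
      smult 2 (hermite_poly (Suc n)) + [:0, 2:] * pderiv (hermite_poly (Suc n))
        - pderiv (pderiv (hermite_poly (Suc n)))"
    unfolding hermite_poly.simps(2)[of "Suc n"]
    by (simp add: pderiv_diff pderiv_mult pderiv_pCons del: hermite_poly.simps mult_pCons_left)
  also have "\<dots> = smult 2 (hermite_poly (Suc n))
      + smult (2 * real (Suc n)) ([:0, 2:] * h - pderiv h)"
    unfolding IH by (simp add: pderiv_smult smult_diff_right del: mult_pCons_left)
  also have "[:0, 2:] * h - pderiv h = hermite_poly (Suc n)"
    by (simp add: h_def)
  finally show ?case
    by (simp add: smult_add_left[symmetric] del: hermite_poly.simps)
qed

text \<open>For n = k + 1 one has H_n' = 2 n H_k, so after division by 2 n the equation is the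
  recursion H_n = 2 x H_k - H_k'.\<close>

lemma hermite_poly_ode:
  "pderiv (pderiv (hermite_poly n)) =
     [:0, 2:] * pderiv (hermite_poly n) - smult (2 * real n) (hermite_poly n)"
proof (cases n)
  case (Suc k)
  show ?thesis
    unfolding Suc pderiv_hermite_poly_Suc
    unfolding hermite_poly.simps(2)
    by (simp add: pderiv_smult smult_diff_right del: mult_pCons_left)
qed simp

lemma hermite_eq_poly: "hermite l t = poly (hermite_poly l) t"
proof -
  have "(deriv ^^ l) (\<lambda>s::real. exp (- s\<^sup>2)) =
      (\<lambda>s. (- 1) ^ l * poly (hermite_poly l) s * exp (- s\<^sup>2))"
  proof (induction l)
    case (Suc l)
    have "((\<lambda>s. (- 1) ^ l * poly (hermite_poly l) s * exp (- s\<^sup>2)) has_real_derivative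
        (- 1) ^ Suc l * poly (hermite_poly (Suc l)) s * exp (- s\<^sup>2)) (at s)" for s :: real
      by (rule derivative_eq_intros refl poly_DERIV | simp add: algebra_simps)+
    then show ?case
      using Suc by (auto intro!: DERIV_imp_deriv)
  qed simp
  then show ?thesis
    by (simp add: hermite_def exp_minus power_mult_distrib[symmetric] flip: mult.assoc)
      (simp add: field_simps flip: power_mult_distrib)
qed


section \<open>Gaussian integrals of polynomials\<close>

text \<open>Integrability and integration by parts are additive in the polynomial, so this rule
  reduces them to single moments.\<close>

lemma poly_monom_add_induct [case_names monom add]:
  fixes p :: "'a::comm_monoid_add poly"
  assumes "\<And>c n. P (monom c n)" and "\<And>p q. P p \<Longrightarrow> P q \<Longrightarrow> P (p + q)"
  shows "P p"
proof -
  have "P (\<Sum>i\<in>A. monom (coeff p i) i)" if "finite A" for A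
    \<comment> \<open>The empty sum is covered by the zero polynomial, which is
      \<open>monom 0 0\<close>.\<close>
    using that assms(1)[of 0 0] by (induction A) (auto intro: assms)
  from this[of "{..degree p}"] show ?thesis
    by (simp add: poly_as_sum_of_monoms)
qed

lemma gaussian_even_moment:
  "has_bochner_integral lborel (\<lambda>x::real. x ^ (2 * k) * exp (- x\<^sup>2))
     (sqrt pi * (fact (2 * k) / (2 ^ (2 * k) * fact k)))"
  using has_bochner_integral_even_function[OF gaussian_moment_even_pos[where k = k]]
  by (simp add: mult.commute)

lemma gaussian_odd_moment:
  "has_bochner_integral lborel (\<lambda>x::real. x ^ (2 * k + 1) * exp (- x\<^sup>2)) 0"
  using has_bochner_integral_odd_function[OF gaussian_moment_odd_pos[where k = k]]
  by (simp add: mult.commute)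

lemma integrable_poly_gaussian: "integrable lborel (\<lambda>x::real. poly p x * exp (- x\<^sup>2))"
proof (induction p rule: poly_monom_add_induct)
  case (monom c n)
  have "integrable lborel (\<lambda>x::real. x ^ n * exp (- x\<^sup>2))"
    using gaussian_even_moment[of "n div 2"] gaussian_odd_moment[of "n div 2"]
    by (cases "even n") (auto simp: has_bochner_integral_iff)
  then have "integrable lborel (\<lambda>x::real. c * (x ^ n * exp (- x\<^sup>2)))"
    by (rule integrable_mult_right)
  then show ?case by (simp add: poly_monom mult.assoc)
next
  case (add p q)
  then show ?case by (simp add: distrib_right)
qed

section \<open>Integration by parts against the Gaussian weight\<close>

definition gauss_int :: "real poly \<Rightarrow> real" where
  "gauss_int p = (LINT x|lborel. poly p x * exp (- x\<^sup>2))"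

lemma gauss_int_add: "gauss_int (p + q) = gauss_int p + gauss_int q"
  by (simp add: gauss_int_def distrib_right integrable_poly_gaussian)

lemma gauss_int_diff: "gauss_int (p - q) = gauss_int p - gauss_int q"
  by (simp add: gauss_int_def left_diff_distrib integrable_poly_gaussian)

lemma gauss_int_smult: "gauss_int (smult c p) = c * gauss_int p"
  by (simp add: gauss_int_def mult.assoc)

lemma gauss_int_monom_even:
  "gauss_int (monom c (2 * k)) = c * (sqrt pi * (fact (2 * k) / (2 ^ (2 * k) * fact k)))"
  using gaussian_even_moment[of k]
  by (simp add: gauss_int_def poly_monom mult.assoc has_bochner_integral_iff)

lemma gauss_int_monom_odd: "gauss_int (monom c (2 * k + 1)) = 0"
  using gaussian_odd_moment[of k]
  by (simp add: gauss_int_def poly_monom mult.assoc has_bochner_integral_iff)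

text \<open>No boundary terms are estimated: on monomials the claim is a relation between explicit
  moments. For even degree both sides are odd moments and vanish.\<close>

lemma gauss_int_by_parts: "gauss_int ([:0, 2:] * p) = gauss_int (pderiv p)"
proof (induction p rule: poly_monom_add_induct)
  case (monom c n)
  have eq: "[:0, 2:] * monom c n = monom (2 * c) (Suc n)"
    by (simp add: monom_altdef smult_smult mult.commute)
  show ?case
  proof (cases "even n")
    case True
    then obtain k where n: "n = 2 * k" by blast
    have "gauss_int (pderiv (monom c n)) = 0"
      \<comment> \<open>The derivative has degree 2 (k - 1) + 1 when k > 0; for k = 0 it is the zero
        polynomial.\<close>
      using gauss_int_monom_odd[of _ "k - 1"] n
      by (cases k) (auto simp: pderiv_monom gauss_int_def)
    with gauss_int_monom_odd[of "2 * c" k] n show ?thesis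
      unfolding eq by simp
  next
    case False
    then obtain k where n: "n = 2 * k + 1" by (elim oddE)
    \<comment> \<open>Consecutive even moments have ratio (2 k + 1) / 2 = n / 2, and the 2 of
      \<open>2 * c\<close> cancels the denominator.\<close>
    have "fact (2 * Suc k) / (2 ^ (2 * Suc k) * fact (Suc k)) =
        real n / 2 * (fact (2 * k) / (2 ^ (2 * k) * fact k))"
    proof -
      have "fact (2 * Suc k) = 2 * real (Suc k) * real n * fact (2 * k)"
        by (simp add: n algebra_simps)
      moreover have "(2::real) ^ (2 * Suc k) * fact (Suc k) =
          4 * real (Suc k) * (2 ^ (2 * k) * fact k)"
        by (simp add: algebra_simps)
      ultimately show ?thesis
        by (simp add: divide_simps del: of_nat_Suc fact_Suc)
    qed
    then have "gauss_int (monom (2 * c) (2 * Suc k)) = gauss_int (monom (real n * c) (2 * k))"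
      unfolding gauss_int_monom_even by simp
    with n show ?thesis
      unfolding eq by (simp add: pderiv_monom)
  qed
next
  case (add p q)
  then show ?case
    by (simp only: distrib_left pderiv_add gauss_int_add)
qed

text \<open>With q = p H_n, the recursion and the product rule give p H_(n+1) = 2 x q - q' + p' H_n;
  the first two terms have equal integrals.\<close>

lemma gauss_int_mult_hermite_poly_Suc:
  "gauss_int (p * hermite_poly (Suc n)) = gauss_int (pderiv p * hermite_poly n)"
proof -
  have "p * hermite_poly (Suc n) =
      [:0, 2:] * (p * hermite_poly n) - pderiv (p * hermite_poly n) + pderiv p * hermite_poly n"
    by (simp add: pderiv_mult algebra_simps del: mult_pCons_left)
  then show ?thesis
    by (simp only: gauss_int_add gauss_int_diff gauss_int_by_parts)
qed

lemma gauss_int_hermite_poly_square: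
  "gauss_int (hermite_poly n * hermite_poly n) = 2 ^ n * fact n * sqrt pi"
proof (induction n)
  case 0
  show ?case
    using gauss_int_monom_even[of 1 0] by simp
next
  case (Suc n)
  then show ?case
    by (simp only: gauss_int_mult_hermite_poly_Suc pderiv_hermite_poly_Suc mult_smult_left
        gauss_int_smult) (simp add: algebra_simps)
qed


section \<open>The one-component oscillator eigenfunctions\<close>

text \<open>The physical constants enter a component only through \<open>a\<close>, which will be
  \<open>m * \<omega> / (hbar * \<xi>k)\<close> for k = 1, 2; then \<open>sqrt a * x\<close> is the
  k-th component of \<open>theta\<close>.\<close>

definition osc :: "real \<Rightarrow> nat \<Rightarrow> real \<Rightarrow> real" where
  "osc a l x = sqrt (sqrt (a / pi) / (2 ^ l * fact l))
     * exp (- (sqrt a * x)\<^sup>2 / 2) * poly (hermite_poly l) (sqrt a * x)"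

definition osc_deriv :: "real \<Rightarrow> nat \<Rightarrow> real \<Rightarrow> real" where
  "osc_deriv a l x = sqrt (sqrt (a / pi) / (2 ^ l * fact l))
     * exp (- (sqrt a * x)\<^sup>2 / 2)
     * (sqrt a * (poly (pderiv (hermite_poly l)) (sqrt a * x)
         - sqrt a * x * poly (hermite_poly l) (sqrt a * x)))"

lemma osc_has_derivative:
  "(osc a l has_real_derivative osc_deriv a l x) (at x)"
  unfolding osc_def[abs_def] osc_deriv_def
  by (rule derivative_eq_intros refl poly_DERIV DERIV_chain'[where g = "poly p" for p]
      | simp add: algebra_simps)+

text \<open>Eliminating h'' by Hermite's equation cancels all terms in h', so the second derivative
  is a multiple of \<open>osc\<close> itself.\<close>

lemma osc_deriv_has_derivative:
  assumes "a > 0"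
  shows "(osc_deriv a l has_real_derivative (a\<^sup>2 * x\<^sup>2 - a * (2 * real l + 1)) * osc a l x) (at x)"
proof -
  define h h' h'' where "h = poly (hermite_poly l) (sqrt a * x)"
    and "h' = poly (pderiv (hermite_poly l)) (sqrt a * x)"
    and "h'' = poly (pderiv (pderiv (hermite_poly l))) (sqrt a * x)"
  define s where "s = sqrt a"
  \<comment> \<open>Positivity of \<open>a\<close> enters here; the final comparison then is a
    polynomial identity in \<open>s\<close>.\<close>
  have a: "a = s\<^sup>2" using assms by (simp add: s_def)
  have h'': "h'' = 2 * s * x * h' - 2 * real l * h"
    by (simp add: h_def h'_def h''_def s_def hermite_poly_ode)
  define c where "c = sqrt (sqrt (a / pi) / (2 ^ l * fact l))"
  have "(osc_deriv a l has_real_derivative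
      c * (exp (- (s * x)\<^sup>2 / 2) * (- s\<^sup>2 * x)) * (s * (h' - s * x * h))
      + c * exp (- (s * x)\<^sup>2 / 2) * (s * (s * h'' - (s * h + s * x * (s * h'))))) (at x)"
    unfolding osc_deriv_def[abs_def] h_def h'_def h''_def c_def s_def
    by (rule derivative_eq_intros refl poly_DERIV DERIV_chain'[where g = "poly p" for p]
      | simp add: algebra_simps power2_eq_square)+
  also have "c * (exp (- (s * x)\<^sup>2 / 2) * (- s\<^sup>2 * x)) * (s * (h' - s * x * h))
      + c * exp (- (s * x)\<^sup>2 / 2) * (s * (s * h'' - (s * h + s * x * (s * h'))))
      = c * exp (- (s * x)\<^sup>2 / 2)
        * (- s\<^sup>2 * x * (s * (h' - s * x * h)) + s * (s * h'' - (s * h + s * x * (s * h'))))"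
    by (simp add: algebra_simps)
  also have "- s\<^sup>2 * x * (s * (h' - s * x * h)) + s * (s * h'' - (s * h + s * x * (s * h')))
      = (a\<^sup>2 * x\<^sup>2 - a * (2 * real l + 1)) * h"
    unfolding h'' a by (simp add: algebra_simps power2_eq_square)
  finally show ?thesis
    by (simp add: osc_def c_def h_def s_def mult_ac)
qed

lemma osc_square_integral:
  assumes "a > 0"
  shows "has_bochner_integral lborel (\<lambda>x. (osc a l x)\<^sup>2) 1"
proof -
  define f where "f = (\<lambda>t::real. poly (hermite_poly l * hermite_poly l) t * exp (- t\<^sup>2))"
  define c where "c = sqrt (a / pi) / (2 ^ l * fact l)"
  have "has_bochner_integral lborel f (2 ^ l * fact l * sqrt pi)"
    using gauss_int_hermite_poly_square[of l]
      integrable_poly_gaussian[of "hermite_poly l * hermite_poly l"]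
    by (simp add: has_bochner_integral_iff f_def gauss_int_def)
  then have "has_bochner_integral lborel (\<lambda>x. f (0 + sqrt a * x))
      ((2 ^ l * fact l * sqrt pi) /\<^sub>R \<bar>sqrt a\<bar>)"
    using assms lborel_has_bochner_integral_real_affine_iff[of "sqrt a" f _ 0] by simp
  then have "has_bochner_integral lborel (\<lambda>x. c * f (0 + sqrt a * x))
      (c * ((2 ^ l * fact l * sqrt pi) /\<^sub>R \<bar>sqrt a\<bar>))"
    by (rule has_bochner_integral_mult_right)
  \<comment> \<open>The factor sqrt (a / pi) in \<open>c\<close> absorbs both sqrt pi and the
    scaling factor of the substitution t = sqrt a * x.\<close>
  also have "c * ((2 ^ l * fact l * sqrt pi) /\<^sub>R \<bar>sqrt a\<bar>) = 1"
    using assms by (simp add: c_def real_sqrt_divide field_simps)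
  also have "(\<lambda>x. c * f (0 + sqrt a * x)) = (\<lambda>x. (osc a l x)\<^sup>2)"
  proof
    fix x
    have "exp (- (sqrt a * x)\<^sup>2) = (exp (- (sqrt a * x)\<^sup>2 / 2))\<^sup>2"
      by (simp flip: exp_double)
    moreover have "(sqrt (sqrt (a / pi) / (2 ^ l * fact l)))\<^sup>2 = c"
      using assms by (simp add: c_def)
    ultimately show "c * f (0 + sqrt a * x) = (osc a l x)\<^sup>2"
      by (simp add: f_def osc_def power_mult_distrib) (simp add: power2_eq_square)
  qed
  finally show ?thesis .
qed

section \<open>Membership of the component functions in \<open>S_space\<close>\<close>

lemma gaussian_poly_in_S_space:
  assumes "\<alpha> > 0"
  shows "(\<lambda>x. complex_of_real (poly p x * exp (- \<alpha> * x\<^sup>2))) \<in> S_space"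
proof -
  let ?A = "(\<lambda>n. (n, \<alpha>)) ` {..degree p}"
  let ?c = "\<lambda>(n, \<alpha>::real). complex_of_real (coeff p n)"
  have "complex_of_real (poly p x * exp (- \<alpha> * x\<^sup>2)) =
      (\<Sum>(n, \<alpha>)\<in>?A. ?c (n, \<alpha>) * of_real (x ^ n * exp (- \<alpha> * x\<^sup>2)))" for x
    by (subst sum.reindex)
      (auto simp: inj_on_def poly_altdef sum_distrib_right mult.assoc)
  moreover have "finite ?A" "\<forall>(n, \<alpha>)\<in>?A. \<alpha> > 0"
    using assms by auto
  ultimately show ?thesis
    unfolding S_space_def by blast
qed

lemma osc_in_S_space:
  assumes "a > 0"
  shows "(\<lambda>x. complex_of_real (osc a l x)) \<in> S_space"
proof -
  let ?c = "sqrt (sqrt (a / pi) / (2 ^ l * fact l))"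
  \<comment> \<open>The rescaled argument is moved into the polynomial, leaving a single Gaussian
    with exponent a / 2.\<close>
  have "osc a l = (\<lambda>x. poly (smult ?c (pcompose (hermite_poly l) [:0, sqrt a:])) x
      * exp (- (a / 2) * x\<^sup>2))"
    using assms by (simp add: osc_def fun_eq_iff poly_pcompose power_mult_distrib mult_ac)
  then show ?thesis
    using gaussian_poly_in_S_space[of "a / 2"] assms by (simp only: half_gt_zero_iff)
qed


section \<open>Componentwise calculation\<close>

text \<open>Together with the rules below, this turns a bicomplex identity into two complex
  ones.\<close>

lemma bicomplex_eq_iff_comp: "w = v \<longleftrightarrow> comp1 w = comp1 v \<and> comp2 w = comp2 v"
  by (auto simp: bicomplex_eq_iff comp1_def comp2_def)

lemma comp_simps:
  "comp1 (w + v) = comp1 w + comp1 v" "comp2 (w + v) = comp2 w + comp2 v"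
  "comp1 (w - v) = comp1 w - comp1 v" "comp2 (w - v) = comp2 w - comp2 v"
  "comp1 (- w) = - comp1 w" "comp2 (- w) = - comp2 w"
  "comp1 (r *\<^sub>R w) = of_real r * comp1 w" "comp2 (r *\<^sub>R w) = of_real r * comp2 w"
  "comp1 (of_real r) = of_real r" "comp2 (of_real r) = of_real r"
  "comp1 (of_Ci1 z) = z" "comp2 (of_Ci1 z) = z"
  "comp1 1 = 1" "comp2 1 = 1"
  "comp1 0 = 0" "comp2 0 = 0"
  "comp1 unit_i1 = \<i>" "comp2 unit_i1 = \<i>"
  "comp1 e1 = 1" "comp2 e1 = 0"
  "comp1 e2 = 0" "comp2 e2 = 1"
  by (simp_all add: comp1_def comp2_def complex_eq_iff e1_def e2_def unit_i1_def unit_j_def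
      of_Ci1_def algebra_simps)

lemma comp_componentwise:
  "comp1 (componentwise f w) = f (comp1 w)" "comp2 (componentwise f w) = f (comp2 w)"
  by (simp_all add: componentwise_def comp_simps comp_mult)

lemma comp_hyp_componentwise:
  "comp1 (hyp_componentwise g w) = of_real (g (Re (comp1 w)))"
  "comp2 (hyp_componentwise g w) = of_real (g (Re (comp2 w)))"
  by (simp_all add: hyp_componentwise_def comp_simps comp_mult)

lemma comp_divide:
  "comp1 (w / v) = comp1 w / comp1 v" "comp2 (w / v) = comp2 w / comp2 v"
  by (simp_all add: divide_bicomplex_def inverse_bicomplex_def comp_mult comp_componentwise
      divide_inverse)

lemma comp_power:
  "comp1 (w ^ n) = comp1 w ^ n" "comp2 (w ^ n) = comp2 w ^ n"
  by (induction n) (simp_all add: comp_simps comp_mult)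

lemma comp_of_nat:
  "comp1 (of_nat n) = of_nat n" "comp2 (of_nat n) = of_nat n"
  by (induction n) (simp_all add: comp_simps)

lemmas comp_all_simps = comp_of_nat comp_simps comp_mult comp_divide comp_power comp_componentwise
  comp_hyp_componentwise

section \<open>Splitting of \<open>phi\<close>, of the squared momentum and of the scalar
  product\<close>

lemma phi_eq_osc:
  assumes "m > 0" "\<omega> > 0" "hbar > 0" "\<xi>1 > 0" "\<xi>2 > 0"
    and "\<xi> = of_real \<xi>1 * e1 + of_real \<xi>2 * e2"
  shows "phi m \<omega> hbar \<xi> l x =
    osc (m * \<omega> / (hbar * \<xi>1)) l x *\<^sub>R e1 + osc (m * \<omega> / (hbar * \<xi>2)) l x *\<^sub>R e2"
proof -
  \<comment> \<open>\<open>hyp_componentwise\<close> applies its function to real parts, so the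
    quotients under the roots must be read as real.\<close>
  have Re_div: "Re (complex_of_real r / complex_of_real s) = r / s" for r s
    by (simp flip: of_real_divide)
  have comp: "comp1 \<xi> = of_real \<xi>1" "comp2 \<xi> = of_real \<xi>2"
    by (simp_all add: assms(6) comp_all_simps)
  show ?thesis
    unfolding bicomplex_eq_iff_comp phi_def theta_def hyp_sqrt_def bc_exp_def hyp_hermite_def osc_def
    by (simp add: comp_all_simps comp hermite_eq_poly exp_of_real
        flip: of_real_mult of_real_divide of_real_power of_real_minus)
qed

text \<open>The Euclidean norm on bicomplex numbers is not submultiplicative; boundedness of
  multiplication by \<open>w\<close> comes instead from linearity in finite dimension.\<close>

lemma mult_has_vector_derivative_bicomplex:
  fixes w :: bicomplex
  assumes "(u has_vector_derivative u') F"
  shows "((\<lambda>x. w * u x) has_vector_derivative w * u') F"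
proof -
  have "linear ((*) w)"
    by (rule linearI) (simp_all add: distrib_left)
  then show ?thesis
    using assms bounded_linear.has_vector_derivative linear_conv_bounded_linear by blast
qed

lemma idempotent_has_vector_derivative:
  assumes "(g1 has_real_derivative d1) (at x)" "(g2 has_real_derivative d2) (at x)"
  shows "((\<lambda>x. g1 x *\<^sub>R e1 + g2 x *\<^sub>R e2) has_vector_derivative d1 *\<^sub>R e1 + d2 *\<^sub>R e2) (at x)"
  using assms by (auto intro!: derivative_eq_intros)

lemma op_P_square_idempotent:
  assumes g1: "\<And>x. (g1 has_real_derivative g1' x) (at x)" "\<And>x. (g1' has_real_derivative g1'' x) (at x)"
    and g2: "\<And>x. (g2 has_real_derivative g2' x) (at x)" "\<And>x. (g2' has_real_derivative g2'' x) (at x)"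
  shows "(op_P hbar \<xi> ^^ 2) (\<lambda>x. g1 x *\<^sub>R e1 + g2 x *\<^sub>R e2) =
    (\<lambda>x. - of_real (hbar\<^sup>2) * \<xi>\<^sup>2 * (g1'' x *\<^sub>R e1 + g2'' x *\<^sub>R e2))"
proof -
  have "op_P hbar \<xi> (\<lambda>x. g1 x *\<^sub>R e1 + g2 x *\<^sub>R e2) =
      (\<lambda>x. (- unit_i1 * of_real hbar * \<xi>) * (g1' x *\<^sub>R e1 + g2' x *\<^sub>R e2))"
    unfolding op_P_def
    by (simp add: vector_derivative_at[OF idempotent_has_vector_derivative[OF g1(1) g2(1)]])
  moreover have "op_P hbar \<xi> \<dots> = (\<lambda>x. (- unit_i1 * of_real hbar * \<xi>) *
      ((- unit_i1 * of_real hbar * \<xi>) * (g1'' x *\<^sub>R e1 + g2'' x *\<^sub>R e2)))"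
    unfolding op_P_def
    by (subst vector_derivative_at[OF mult_has_vector_derivative_bicomplex[OF
            idempotent_has_vector_derivative[OF g1(2) g2(2)]]]) simp
  \<comment> \<open>The constant prefactor passes through the second derivative, and the square of
    \<open>unit_i1\<close> supplies the sign.\<close>
  moreover have "(- unit_i1 * of_real hbar * \<xi>) * ((- unit_i1 * of_real hbar * \<xi>) * v) =
      - of_real (hbar\<^sup>2) * \<xi>\<^sup>2 * v" for v
    by (simp add: bicomplex_eq_iff_comp comp_all_simps power2_eq_square mult_ac)
  ultimately show ?thesis
    by (simp add: numeral_2_eq_2)
qed

text \<open>Here \<open>y\<close> stands for the value of the eigenfunction. Since hbar s a = m
  \<omega>, the x^2 part of the kinetic term cancels the potential and the constant part is the
  energy.\<close>

lemma osc_energy: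
  fixes m \<omega> hbar y s :: real
  assumes "m > 0" "hbar > 0" "s > 0"
  defines "a \<equiv> m * \<omega> / (hbar * s)"
  shows "1 / (2 * m) * (- hbar\<^sup>2 * s\<^sup>2 * ((a\<^sup>2 * x\<^sup>2 - a * (2 * real l + 1)) * y))
      + 1 / 2 * m * \<omega>\<^sup>2 * (x * (x * y)) = (real l + 1 / 2) * hbar * \<omega> * s * y"
  using assms(1-3) unfolding a_def by (simp add: field_simps power2_eq_square)

text \<open>Conjugation fixes numbers with real components, and e1 e2 = 0 removes the cross terms,
  so each component contributes its own square.\<close>

lemma scalar_product_idempotent:
  assumes "has_bochner_integral lborel (\<lambda>x. (g1 x)\<^sup>2) c1" "has_bochner_integral lborel (\<lambda>x. (g2 x)\<^sup>2) c2"
  shows "scalar_product (\<lambda>x. g1 x *\<^sub>R e1 + g2 x *\<^sub>R e2) (\<lambda>x. g1 x *\<^sub>R e1 + g2 x *\<^sub>R e2) =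
    c1 *\<^sub>R e1 + c2 *\<^sub>R e2"
proof -
  have "bc_cnj (g1 x *\<^sub>R e1 + g2 x *\<^sub>R e2) * (g1 x *\<^sub>R e1 + g2 x *\<^sub>R e2) =
      (g1 x)\<^sup>2 *\<^sub>R e1 + (g2 x)\<^sup>2 *\<^sub>R e2" for x
    by (simp add: bicomplex_eq_iff_comp bc_cnj_def comp_all_simps power2_eq_square)
  moreover have "has_bochner_integral lborel (\<lambda>x. (g1 x)\<^sup>2 *\<^sub>R e1 + (g2 x)\<^sup>2 *\<^sub>R e2) (c1 *\<^sub>R e1 + c2 *\<^sub>R e2)"
    by (intro has_bochner_integral_add has_bochner_integral_scaleR_left assms)
  ultimately show ?thesis
    by (simp add: scalar_product_def has_bochner_integral_iff)
qed

theorem mainTheorem4: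
  fixes m \<omega> hbar \<xi>1 \<xi>2 :: real and \<xi> :: bicomplex and l :: nat
  assumes "m > 0" and "\<omega> > 0" and "hbar > 0"
    and "\<xi>1 > 0" and "\<xi>2 > 0" and "\<xi> = of_real \<xi>1 * e1 + of_real \<xi>2 * e2"
  shows "phi m \<omega> hbar \<xi> l \<in> M_S
    \<and> eigenfunction (op_H m \<omega> hbar \<xi>) (of_real ((real l + 1 / 2) * hbar * \<omega>) * \<xi>) (phi m \<omega> hbar \<xi> l)
    \<and> scalar_product (phi m \<omega> hbar \<xi> l) (phi m \<omega> hbar \<xi> l) = 1"
proof -
  define a1 a2 where "a1 = m * \<omega> / (hbar * \<xi>1)" and "a2 = m * \<omega> / (hbar * \<xi>2)"
  have pos: "a1 > 0" "a2 > 0"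
    using assms by (simp_all add: a1_def a2_def)
  define u where "u = (\<lambda>x. osc a1 l x *\<^sub>R e1 + osc a2 l x *\<^sub>R e2)"
  have phi: "phi m \<omega> hbar \<xi> l = u"
    using phi_eq_osc[OF assms] by (simp add: u_def a1_def a2_def fun_eq_iff)
  have "u = (\<lambda>x. e1 * of_Ci1 (of_real (osc a1 l x)) + e2 * of_Ci1 (of_real (osc a2 l x)))"
    by (simp add: fun_eq_iff u_def bicomplex_eq_iff_comp comp_all_simps)
  then have M: "u \<in> M_S"
    using osc_in_S_space[OF pos(1), of l] osc_in_S_space[OF pos(2), of l]
    unfolding M_S_def mem_Collect_eq by (intro bexI)
  have norm: "scalar_product u u = 1"
    unfolding u_def using scalar_product_idempotent[OF osc_square_integral osc_square_integral] pos
    by (simp add: idempotents)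
  \<comment> \<open>A function of norm 1 cannot vanish identically.\<close>
  have nonzero: "u \<noteq> (\<lambda>x. 0)"
  proof
    assume "u = (\<lambda>x. 0)"
    then have "scalar_product u u = 0"
      by (simp add: scalar_product_def)
    with norm show False by simp
  qed
  have comp: "comp1 \<xi> = of_real \<xi>1" "comp2 \<xi> = of_real \<xi>2"
    by (simp_all add: assms(6) comp_all_simps)
  have "op_H m \<omega> hbar \<xi> u x = of_real ((real l + 1 / 2) * hbar * \<omega>) * \<xi> * u x" for x
  proof -
    \<comment> \<open>For positive \<open>a\<close> this is the second derivative of
      \<open>osc a l\<close> at \<open>x\<close>.\<close>
    define f where "f a = (a\<^sup>2 * x\<^sup>2 - a * (2 * real l + 1)) * osc a l x" for a
    have "op_H m \<omega> hbar \<xi> u x =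
        of_real (1 / (2 * m)) * (- of_real (hbar\<^sup>2) * \<xi>\<^sup>2 * (f a1 *\<^sub>R e1 + f a2 *\<^sub>R e2))
        + of_real (1 / 2 * m * \<omega>\<^sup>2) * (of_real x * (of_real x * u x))"
      unfolding op_H_def u_def f_def
        op_P_square_idempotent[OF osc_has_derivative osc_deriv_has_derivative[OF pos(1)]
          osc_has_derivative osc_deriv_has_derivative[OF pos(2)]]
      by (simp add: numeral_2_eq_2 op_X_def)
    also have "\<dots> = of_real ((real l + 1 / 2) * hbar * \<omega>) * \<xi> * u x"
    proof -
      \<comment> \<open>Taking s = \<open>\<xi>1\<close> and s = \<open>\<xi>2\<close> gives the two
        idempotent components; the cast to complex matches the values of \<open>comp1\<close> and
        \<open>comp2\<close>.\<close>
      have "complex_of_real (1 / (2 * m) * (- hbar\<^sup>2 * s\<^sup>2 * f (m * \<omega> / (hbar * s)))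
          + 1 / 2 * m * \<omega>\<^sup>2 * (x * (x * osc (m * \<omega> / (hbar * s)) l x))) =
          complex_of_real ((real l + 1 / 2) * hbar * \<omega> * s * osc (m * \<omega> / (hbar * s)) l x)"
        if "s > 0" for s
        unfolding f_def by (simp only: osc_energy[OF assms(1,3) that])
      note this[OF assms(4)] this[OF assms(5)]
      then show ?thesis
        unfolding bicomplex_eq_iff_comp
        by (simp add: u_def comp_all_simps comp a1_def[symmetric] a2_def[symmetric])
    qed
    finally show ?thesis .
  qed
  then have "eigenfunction (op_H m \<omega> hbar \<xi>) (of_real ((real l + 1 / 2) * hbar * \<omega>) * \<xi>) u"
    using M nonzero by (simp add: eigenfunction_def fun_eq_iff)
  with M norm show ?thesis
    by (simp add: phi)
qed

end
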